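(* Let $\mathcal{P}=\{p_1<\cdots<p_{l-1}\}$ be a finite nonempty set of primes and let $\beta_{\mathcal{P}}=\min\{1/3,1/p_{l-1}\}$. Then every cylinder absolute winning subset of $X_{\mathcal{P}}$ is $\alpha$-strong winning for all $0<\alpha<\beta_{\mathcal{P}}$.
   Context: Setting. $X_{\mathcal{P}}=\mathbb{R}\times\prod_{p\in\mathcal{P}}\mathbb{Q}_p$, with elements $\mathbf{x}=(x_0,x_1,\dots,x_{l-1})$, $x_0\in\mathbb{R}$, $x_i\in\mathbb{Q}_{p_i}$, and metric $d(\mathbf{x},\mathbf{z})=\max\{|x_0-z_0|,\ \sup_{i\ge1}p_i^{-1}|x_i-z_i|_{p_i}\}$, with $|\cdot|_p$ the usual $p$-adic absolute value ($|p|_p=1/p$). $\overline{B}(\mathbf{x},r)=\{\mathbf{z}: d(\mathbf{x},\mathbf{z})\le r\}$ is the closed ball of radius $r>0$. Cylinders. For $\mathbf{x}\in X_{\mathcal{P}}$, $\varepsilon>0$, the open cylinder $C(\mathbf{x},\varepsilon,i)$ with constraining coordinate $i$ is $\{\mathbf{z}:|z_0-x_0|<\varepsilon\}$ if $i=0$ and $\{\mathbf{z}:|z_i-x_i|_{p_i}<p_i\varepsilon\}$ if $i>0$. Its radius is $\varepsilon$ if $i=0$, and the infimum of all $\varepsilon'>0$ with $C(\mathbf{x},\varepsilon',i)=C(\mathbf{x},\varepsilon,i)$ if $i>0$. Cylinder absolute game. Let $F\subset X_{\mathcal{P}}$ and $0<\beta<1$. In the cylinder $\beta$-absolute game Bob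 first chooses a closed ball $B_0$. For $j\ge1$, given $B_{j-1}$, Alice chooses an open cylinder $C_j$ of radius at most $\beta\cdot\mathrm{radius}(B_{j-1})$, and then Bob chooses a closed ball $B_j\subset B_{j-1}\setminus C_j$ with $\mathrm{radius}(B_j)\ge\beta\cdot\mathrm{radius}(B_{j-1})$. If at some finite stage Bob has no legal choice, Bob wins; otherwise Alice wins iff $\bigcap_j B_j\cap F\ne\emptyset$. $F$ is cylinder $\beta$-absolute winning if Alice has a winning strategy, and cylinder absolute winning (CAW) if there is $0<\beta_1\le1/3$ such that it is cylinder $\beta$-absolute winning for all $\beta\in(0,\beta_1)$. Strong game. For $\alpha,\gamma\in(0,1)$, in the $(\alpha,\gamma)$-strong game with target $F$, Bob first picks a closed ball $B_0$; then alternately Alice picks a closed ball $A_{i+1}\subset B_i$ with $|A_{i+1}|\ge\alpha|B_i|$ and Bob picks a closed ball $B_{i+1}\subset A_{i+1}$ with $|B_{i+1}|\ge\gamma|A_{i+1}|$ ($i\ge0$), where $|\cdot|$ denotes diameter. Alice wins iff $\bigcap_i B_i\cap F\neq\emptyset$. $F$ is $(\alpha,\gamma)$-strong winning if Alice has a winning strategy, and $\alpha$-strong winning if it is $(\alpha,\gamma)$-strong winning for all $\gamma\in(0,1)$. *)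

theory Defs
  imports "HOL-Analysis.Analysis" "HOL-Computational_Algebra.Primes"
begin

section \<open>The field of \<open>p\<close>-adic numbers as a metric completion of the rationals\<close>

text \<open>
  Since \<open>p\<close> ranges over a finite set of primes that is itself a variable, the \<open>p\<close>-adic numbers
  form a carrier set indexed by \<open>p\<close>, not a type: equivalence classes of rational sequences that
  are Cauchy for the \<open>p\<close>-adic absolute value, modulo null sequences.  Only the
  difference and the absolute value enter the metric below.
\<close>

definition rat_padic_abs :: "nat \<Rightarrow> rat \<Rightarrow> real" where
  "rat_padic_abs p q =
     (if q = 0 then 0
      else real p powi (int (multiplicity (int p) (snd (quotient_of q)))
                        - int (multiplicity (int p) (fst (quotient_of q)))))"

definition padic_cauchy :: "nat \<Rightarrow> (nat \<Rightarrow> rat) set" where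
  "padic_cauchy p = {s. \<forall>e>0. \<exists>N. \<forall>m\<ge>N. \<forall>n\<ge>N. rat_padic_abs p (s m - s n) < e}"

definition padic_rel :: "nat \<Rightarrow> ((nat \<Rightarrow> rat) \<times> (nat \<Rightarrow> rat)) set" where
  "padic_rel p = {(s, t). s \<in> padic_cauchy p \<and> t \<in> padic_cauchy p \<and>
     (\<lambda>n. rat_padic_abs p (s n - t n)) \<longlonglongrightarrow> 0}"

definition padics :: "nat \<Rightarrow> (nat \<Rightarrow> rat) set set" where
  "padics p = padic_cauchy p // padic_rel p"

definition padic_diff :: "nat \<Rightarrow> (nat \<Rightarrow> rat) set \<Rightarrow> (nat \<Rightarrow> rat) set \<Rightarrow> (nat \<Rightarrow> rat) set" where
  "padic_diff p x y = (\<Union>s\<in>x. \<Union>t\<in>y. padic_rel p `` {\<lambda>n. s n - t n})"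

definition padic_abs :: "nat \<Rightarrow> (nat \<Rightarrow> rat) set \<Rightarrow> real" where
  "padic_abs p x = (THE c. \<forall>s\<in>x. (\<lambda>n. rat_padic_abs p (s n)) \<longlonglongrightarrow> c)"

lemma rat_padic_abs_nonneg: "rat_padic_abs p q \<ge> 0"
  by (simp add: rat_padic_abs_def)

lemma rat_padic_abs_zero [simp]: "rat_padic_abs p 0 = 0"
  by (simp add: rat_padic_abs_def)

lemma rat_padic_abs_eq:
  assumes p: "prime p" and "a \<noteq> 0" "b \<noteq> 0"
  shows "rat_padic_abs p (of_int a / of_int b) =
           real p powi (int (multiplicity (int p) b) - int (multiplicity (int p) a))"
proof -
  obtain c d where q: "quotient_of (of_int a / of_int b) = (c, d)" by fastforce
  have d: "d > 0" using quotient_of_denom_pos[OF q] .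
  have e: "(of_int a / of_int b :: rat) = of_int c / of_int d" using quotient_of_div[OF q] .
  have c: "c \<noteq> 0" using e assms d by auto
  have "(of_int (a * d) :: rat) = of_int (c * b)"
    using e assms d by (simp add: field_simps)
  hence eq: "a * d = c * b" by (simp only: of_int_eq_iff)
  have pe: "prime_elem (int p)" using p by simp
  have "multiplicity (int p) (a * d) = multiplicity (int p) (c * b)" using eq by simp
  hence "multiplicity (int p) a + multiplicity (int p) d
           = multiplicity (int p) c + multiplicity (int p) b"
    using pe assms c d by (simp add: prime_elem_multiplicity_mult_distrib)
  hence "int (multiplicity (int p) d) - int (multiplicity (int p) c)
           = int (multiplicity (int p) b) - int (multiplicity (int p) a)" by linarith
  thus ?thesis using assms q by (simp add: rat_padic_abs_def)
qed

lemma rat_padic_abs_minus: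
  assumes "prime p" shows "rat_padic_abs p (- q) = rat_padic_abs p q"
proof (cases "q = 0")
  case False
  obtain a b where q: "quotient_of q = (a, b)" by fastforce
  have b: "b > 0" using quotient_of_denom_pos[OF q] .
  have e: "q = of_int a / of_int b" using quotient_of_div[OF q] .
  have "- q = of_int (- a) / of_int b" using e by simp
  moreover have "a \<noteq> 0" using e False by auto
  moreover have m: "multiplicity (int p) (- a) = multiplicity (int p) a"
    using multiplicity_times_unit_right[of "-1" "int p" a] by simp
  ultimately show ?thesis
    using rat_padic_abs_eq[OF assms, of a b] rat_padic_abs_eq[OF assms, of "-a" b] b e
    by (simp add: m)
qed simp

lemma rat_padic_abs_diff_commute:
  "prime p \<Longrightarrow> rat_padic_abs p (a - b) = rat_padic_abs p (b - a)"
  by (metis minus_diff_eq rat_padic_abs_minus)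

lemma rat_padic_abs_add_le_max:
  assumes p: "prime p"
  shows "rat_padic_abs p (q + r) \<le> max (rat_padic_abs p q) (rat_padic_abs p r)"
proof (cases "q = 0 \<or> r = 0 \<or> q + r = 0")
  case True
  thus ?thesis using rat_padic_abs_nonneg[of p q] by auto
next
  case False
  obtain a b where q: "quotient_of q = (a, b)" by fastforce
  obtain c d where r: "quotient_of r = (c, d)" by fastforce
  have b: "b > 0" using quotient_of_denom_pos[OF q] .
  have d: "d > 0" using quotient_of_denom_pos[OF r] .
  have q': "q = of_int (a * d) / of_int (b * d)" using quotient_of_div[OF q] d by simp
  have r': "r = of_int (c * b) / of_int (b * d)" using quotient_of_div[OF r] b by simp
  have s': "q + r = of_int (a * d + c * b) / of_int (b * d)"
    using q' r' by (simp add: add_divide_distrib)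
  have nz: "a * d \<noteq> 0" "c * b \<noteq> 0" "a * d + c * b \<noteq> 0" "b * d \<noteq> 0"
    using q' r' s' False b d by (metis div_0 of_int_0 less_irrefl mult_eq_0_iff)+
  let ?m = "multiplicity (int p)"
  have nu: "\<not> is_unit (int p)" using p by (metis not_prime_unit prime_nat_int_transfer)
  have "int p ^ min (?m (a * d)) (?m (c * b)) dvd a * d + c * b"
    by (intro dvd_add multiplicity_dvd') auto
  hence m: "min (?m (a * d)) (?m (c * b)) \<le> ?m (a * d + c * b)"
    using nz nu by (intro multiplicity_geI) auto
  have p1: "real p \<ge> 1" using prime_gt_1_nat[OF p] by simp
  have "real p powi (int (?m (b * d)) - int (?m (a * d + c * b)))
      \<le> max (real p powi (int (?m (b * d)) - int (?m (a * d))))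
            (real p powi (int (?m (b * d)) - int (?m (c * b))))"
  proof (cases "?m (a * d) \<le> ?m (c * b)")
    case True
    thus ?thesis using m by (intro max.coboundedI1 power_int_increasing[OF _ p1]) auto
  next
    case False
    thus ?thesis using m by (intro max.coboundedI2 power_int_increasing[OF _ p1]) auto
  qed
  thus ?thesis
    unfolding s' unfolding q' r' using nz by (simp only: rat_padic_abs_eq[OF p] not_False_eq_True)
qed

lemma rat_padic_abs_triangle:
  assumes "prime p"
  shows "rat_padic_abs p (q + r) \<le> rat_padic_abs p q + rat_padic_abs p r"
  using rat_padic_abs_add_le_max[OF assms, of q r] rat_padic_abs_nonneg[of p q]
    rat_padic_abs_nonneg[of p r] by linarith

lemma rat_padic_abs_diff_triangle:
  assumes "prime p"
  shows "\<bar>rat_padic_abs p q - rat_padic_abs p r\<bar> \<le> rat_padic_abs p (q - r)"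
  using rat_padic_abs_triangle[OF assms, of "q - r" r]
    rat_padic_abs_triangle[OF assms, of "r - q" q] rat_padic_abs_diff_commute[OF assms, of q r]
  by (auto simp: abs_le_iff)

lemma null_dominated:
  fixes f g :: "nat \<Rightarrow> real"
  assumes "\<And>n. 0 \<le> f n" "\<And>n. f n \<le> g n" "g \<longlonglongrightarrow> 0"
  shows "f \<longlonglongrightarrow> 0"
  using assms by (intro tendsto_sandwich[OF _ _ tendsto_const assms(3)]) simp_all

lemma equiv_padic_rel:
  assumes p: "prime p" shows "equiv (padic_cauchy p) (padic_rel p)"
proof (rule equivI)
  show "padic_rel p \<subseteq> padic_cauchy p \<times> padic_cauchy p" by (auto simp: padic_rel_def)
  show "refl_on (padic_cauchy p) (padic_rel p)" by (auto simp: refl_on_def padic_rel_def)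
  show "sym (padic_rel p)"
  proof (rule symI)
    fix s t assume "(s, t) \<in> padic_rel p"
    thus "(t, s) \<in> padic_rel p"
      unfolding padic_rel_def by (subst rat_padic_abs_diff_commute[OF p]) simp
  qed
  show "trans (padic_rel p)"
  proof (rule transI)
    fix s t u assume st: "(s, t) \<in> padic_rel p" and tu: "(t, u) \<in> padic_rel p"
    have "(\<lambda>n. rat_padic_abs p (s n - t n) + rat_padic_abs p (t n - u n)) \<longlonglongrightarrow> 0 + 0"
      using st tu by (intro tendsto_add) (auto simp: padic_rel_def)
    hence lim: "(\<lambda>n. rat_padic_abs p (s n - t n) + rat_padic_abs p (t n - u n)) \<longlonglongrightarrow> 0"
      by simp
    have "rat_padic_abs p (s n - u n)
        \<le> rat_padic_abs p (s n - t n) + rat_padic_abs p (t n - u n)" for n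
      using rat_padic_abs_triangle[OF p, of "s n - t n" "t n - u n"] by simp
    hence "(\<lambda>n. rat_padic_abs p (s n - u n)) \<longlonglongrightarrow> 0"
      by (intro null_dominated[OF rat_padic_abs_nonneg _ lim])
    thus "(s, u) \<in> padic_rel p" using st tu unfolding padic_rel_def by blast
  qed
qed

lemma padic_cauchy_diff:
  assumes p: "prime p" and "s \<in> padic_cauchy p" "t \<in> padic_cauchy p"
  shows "(\<lambda>n. s n - t n) \<in> padic_cauchy p"
  unfolding padic_cauchy_def
proof (intro CollectI allI impI)
  fix e :: real assume "e > 0"
  obtain M where M: "\<And>m n. m \<ge> M \<Longrightarrow> n \<ge> M \<Longrightarrow> rat_padic_abs p (s m - s n) < e"
    using \<open>e > 0\<close> assms(2) unfolding padic_cauchy_def by blast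
  obtain N where N: "\<And>m n. m \<ge> N \<Longrightarrow> n \<ge> N \<Longrightarrow> rat_padic_abs p (t m - t n) < e"
    using \<open>e > 0\<close> assms(3) unfolding padic_cauchy_def by blast
  have "rat_padic_abs p (s m - t m - (s n - t n)) < e"
    if "m \<ge> max M N" "n \<ge> max M N" for m n
  proof -
    have "s m - t m - (s n - t n) = (s m - s n) + (t n - t m)" by simp
    hence "rat_padic_abs p (s m - t m - (s n - t n))
             \<le> max (rat_padic_abs p (s m - s n)) (rat_padic_abs p (t n - t m))"
      using rat_padic_abs_add_le_max[OF p] by metis
    thus ?thesis using M[of m n] N[of n m] that by auto
  qed
  thus "\<exists>K. \<forall>m\<ge>K. \<forall>n\<ge>K. rat_padic_abs p (s m - t m - (s n - t n)) < e" by blast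
qed

lemma padic_diff_class:
  assumes p: "prime p" and s: "s \<in> padic_cauchy p" and t: "t \<in> padic_cauchy p"
  shows "padic_diff p (padic_rel p `` {s}) (padic_rel p `` {t}) = padic_rel p `` {\<lambda>n. s n - t n}"
proof -
  have *: "padic_rel p `` {\<lambda>n. s' n - t' n} = padic_rel p `` {\<lambda>n. s n - t n}"
    if "(s, s') \<in> padic_rel p" "(t, t') \<in> padic_rel p" for s' t'
  proof (rule equiv_class_eq[OF equiv_padic_rel[OF p]])
    have "(\<lambda>n. rat_padic_abs p (s n - s' n) + rat_padic_abs p (t n - t' n)) \<longlonglongrightarrow> 0 + 0"
      using that by (intro tendsto_add) (auto simp: padic_rel_def)
    hence lim: "(\<lambda>n. rat_padic_abs p (s n - s' n) + rat_padic_abs p (t n - t' n)) \<longlonglongrightarrow> 0"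
      by simp
    have "rat_padic_abs p (s' n - t' n - (s n - t n))
        \<le> rat_padic_abs p (s n - s' n) + rat_padic_abs p (t n - t' n)" for n
      using rat_padic_abs_triangle[OF p, of "s' n - s n" "t n - t' n"]
        rat_padic_abs_diff_commute[OF p, of "s n" "s' n"] by (simp add: algebra_simps)
    hence "(\<lambda>n. rat_padic_abs p (s' n - t' n - (s n - t n))) \<longlonglongrightarrow> 0"
      by (intro null_dominated[OF rat_padic_abs_nonneg _ lim])
    thus "(\<lambda>n. s' n - t' n, \<lambda>n. s n - t n) \<in> padic_rel p"
      using that padic_cauchy_diff[OF p] s t by (auto simp: padic_rel_def)
  qed
  have "(s, s) \<in> padic_rel p" "(t, t) \<in> padic_rel p"
    using s t by (auto simp: padic_rel_def)
  hence ne: "padic_rel p `` {s} \<noteq> {}" "padic_rel p `` {t} \<noteq> {}" by auto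
  have "padic_diff p (padic_rel p `` {s}) (padic_rel p `` {t})
      = (\<Union>s'\<in>padic_rel p `` {s}. \<Union>t'\<in>padic_rel p `` {t}. padic_rel p `` {\<lambda>n. s n - t n})"
    unfolding padic_diff_def by (intro SUP_cong refl *) simp_all
  also have "\<dots> = padic_rel p `` {\<lambda>n. s n - t n}" using ne by simp
  finally show ?thesis .
qed

lemma padic_abs_class:
  assumes p: "prime p" and s: "s \<in> padic_cauchy p"
  shows "(\<lambda>n. rat_padic_abs p (s n)) \<longlonglongrightarrow> padic_abs p (padic_rel p `` {s})"
proof -
  have "Cauchy (\<lambda>n. rat_padic_abs p (s n))"
  proof (rule metric_CauchyI)
    fix e :: real assume "e > 0"
    then obtain N where N: "\<And>m n. m \<ge> N \<Longrightarrow> n \<ge> N \<Longrightarrow> rat_padic_abs p (s m - s n) < e"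
      using s unfolding padic_cauchy_def by blast
    show "\<exists>M. \<forall>m\<ge>M. \<forall>n\<ge>M. dist (rat_padic_abs p (s m)) (rat_padic_abs p (s n)) < e"
      using N rat_padic_abs_diff_triangle[OF p] unfolding dist_real_def by (meson le_less_trans)
  qed
  then obtain c where c: "(\<lambda>n. rat_padic_abs p (s n)) \<longlonglongrightarrow> c"
    using Cauchy_convergent_iff convergent_def by blast
  have "(\<lambda>n. rat_padic_abs p (t n)) \<longlonglongrightarrow> c" if "(s, t) \<in> padic_rel p" for t
  proof -
    have "(\<lambda>n. rat_padic_abs p (s n - t n)) \<longlonglongrightarrow> 0" using that by (auto simp: padic_rel_def)
    hence "(\<lambda>n. rat_padic_abs p (s n) - rat_padic_abs p (t n)) \<longlonglongrightarrow> 0"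
      by (rule Lim_null_comparison[rotated])
        (use rat_padic_abs_diff_triangle[OF p] in auto)
    from tendsto_diff[OF c this] show ?thesis by simp
  qed
  moreover have "(s, s) \<in> padic_rel p" using s by (auto simp: padic_rel_def)
  ultimately have "padic_abs p (padic_rel p `` {s}) = c"
    unfolding padic_abs_def by (intro the_equality) (auto intro: LIMSEQ_unique[OF _ c])
  thus ?thesis using c by simp
qed

lemma padicsE:
  assumes "x \<in> padics p"
  obtains s where "s \<in> padic_cauchy p" "x = padic_rel p `` {s}"
  using assms unfolding padics_def by (rule quotientE)

lemma padic_abs_diff_class:
  assumes "prime p" "s \<in> padic_cauchy p" "t \<in> padic_cauchy p"
  shows "(\<lambda>n. rat_padic_abs p (s n - t n))
           \<longlonglongrightarrow> padic_abs p (padic_diff p (padic_rel p `` {s}) (padic_rel p `` {t}))"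
  using padic_abs_class[OF assms(1) padic_cauchy_diff[OF assms]] padic_diff_class[OF assms] by simp

lemma padic_abs_diff_nonneg:
  assumes "prime p" "x \<in> padics p" "y \<in> padics p"
  shows "padic_abs p (padic_diff p x y) \<ge> 0"
proof -
  obtain s t where "s \<in> padic_cauchy p" "x = padic_rel p `` {s}"
    "t \<in> padic_cauchy p" "y = padic_rel p `` {t}" using assms by (auto elim!: padicsE)
  thus ?thesis using LIMSEQ_le_const[OF padic_abs_diff_class[of p s t]] assms(1)
    by (auto simp: rat_padic_abs_nonneg)
qed

lemma padic_abs_diff_commute:
  assumes "prime p" "x \<in> padics p" "y \<in> padics p"
  shows "padic_abs p (padic_diff p x y) = padic_abs p (padic_diff p y x)"
proof -
  obtain s t where *: "s \<in> padic_cauchy p" "x = padic_rel p `` {s}"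
    "t \<in> padic_cauchy p" "y = padic_rel p `` {t}" using assms by (auto elim!: padicsE)
  have "(\<lambda>n. rat_padic_abs p (s n - t n)) = (\<lambda>n. rat_padic_abs p (t n - s n))"
    using rat_padic_abs_diff_commute[OF assms(1)] by auto
  thus ?thesis
    using LIMSEQ_unique[OF padic_abs_diff_class[of p s t]] padic_abs_diff_class[of p t s] * assms(1)
    by auto
qed

lemma padic_abs_diff_eq_0_iff:
  assumes "prime p" "x \<in> padics p" "y \<in> padics p"
  shows "padic_abs p (padic_diff p x y) = 0 \<longleftrightarrow> x = y"
proof -
  obtain s t where *: "s \<in> padic_cauchy p" "x = padic_rel p `` {s}"
    "t \<in> padic_cauchy p" "y = padic_rel p `` {t}" using assms by (auto elim!: padicsE)
  have "x = y \<longleftrightarrow> (s, t) \<in> padic_rel p"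
    using * eq_equiv_class_iff[OF equiv_padic_rel[OF assms(1)]] by simp
  also have "\<dots> \<longleftrightarrow> (\<lambda>n. rat_padic_abs p (s n - t n)) \<longlonglongrightarrow> 0"
    using * by (auto simp: padic_rel_def)
  also have "\<dots> \<longleftrightarrow> padic_abs p (padic_diff p x y) = 0"
    using padic_abs_diff_class[of p s t] LIMSEQ_unique * assms(1) by metis
  finally show ?thesis by simp
qed

lemma padic_abs_diff_ultrametric:
  assumes "prime p" "x \<in> padics p" "y \<in> padics p" "z \<in> padics p"
  shows "padic_abs p (padic_diff p x z)
           \<le> max (padic_abs p (padic_diff p x y)) (padic_abs p (padic_diff p y z))"
proof -
  obtain s t u where *: "s \<in> padic_cauchy p" "x = padic_rel p `` {s}"
    "t \<in> padic_cauchy p" "y = padic_rel p `` {t}"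
    "u \<in> padic_cauchy p" "z = padic_rel p `` {u}" using assms by (auto elim!: padicsE)
  have "rat_padic_abs p (s n - u n)
      \<le> max (rat_padic_abs p (s n - t n)) (rat_padic_abs p (t n - u n))" for n
    using rat_padic_abs_add_le_max[OF assms(1), of "s n - t n" "t n - u n"] by simp
  thus ?thesis unfolding * using * assms(1)
    by (intro LIMSEQ_le[OF padic_abs_diff_class tendsto_max[OF padic_abs_diff_class
          padic_abs_diff_class]]) auto
qed

section \<open>The space \<open>\<real> \<times> \<Prod>\<^bsub>p\<in>P\<^esub> \<rat>\<^sub>p\<close>\<close>

text \<open>
  The \<open>p\<close>-adic coordinates are indexed by the primes in \<open>P\<close> themselves.
\<close>

type_synonym point = "real \<times> (nat \<Rightarrow> (nat \<Rightarrow> rat) set)"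

definition XP :: "nat set \<Rightarrow> point set" where
  "XP P = UNIV \<times> (\<Pi>\<^sub>E p\<in>P. padics p)"

text \<open>
  The value \<open>0\<close> off the carrier is there because \<^locale>\<open>Metric_space\<close> asks for a symmetric
  function on the whole type.
\<close>

definition XP_dist :: "nat set \<Rightarrow> point \<Rightarrow> point \<Rightarrow> real" where
  "XP_dist P x z =
     (if x \<in> XP P \<and> z \<in> XP P
      then max \<bar>fst x - fst z\<bar> (SUP p\<in>P. padic_abs p (padic_diff p (snd x p) (snd z p)) / real p)
      else 0)"

lemma Metric_space_XP:
  assumes fin: "finite P" and ne: "P \<noteq> {}" and pr: "\<And>p. p \<in> P \<Longrightarrow> prime p"
  shows "Metric_space (XP P) (XP_dist P)"
proof
  let ?f = "\<lambda>x z p. padic_abs p (padic_diff p (snd x p) (snd z p)) / real p"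
  have le: "XP_dist P x z \<le> c \<longleftrightarrow> \<bar>fst x - fst z\<bar> \<le> c \<and> (\<forall>p\<in>P. ?f x z p \<le> c)"
    if "x \<in> XP P" "z \<in> XP P" for x z c
    using that fin ne by (auto simp: XP_dist_def cSUP_le_iff)
  have mem: "snd x p \<in> padics p" if "x \<in> XP P" "p \<in> P" for x p
    using that by (auto simp: XP_def)
  show nn: "0 \<le> XP_dist P x y" for x y
    by (auto simp: XP_dist_def le_max_iff_disj)
  show "XP_dist P x y = XP_dist P y x" for x y
  proof (cases "x \<in> XP P \<and> y \<in> XP P")
    case True
    hence "(SUP p\<in>P. ?f x y p) = (SUP p\<in>P. ?f y x p)"
      using mem pr by (intro SUP_cong refl) (auto simp: padic_abs_diff_commute)
    thus ?thesis by (simp add: XP_dist_def abs_minus_commute)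
  qed (auto simp: XP_dist_def)
  show "XP_dist P x y = 0 \<longleftrightarrow> x = y" if x: "x \<in> XP P" and y: "y \<in> XP P" for x y
  proof -
    have "XP_dist P x y = 0 \<longleftrightarrow> XP_dist P x y \<le> 0" using nn[of x y] by linarith
    also have "\<dots> \<longleftrightarrow> fst x = fst y \<and> (\<forall>p\<in>P. snd x p = snd y p)"
    proof -
      have "?f x y p \<le> 0 \<longleftrightarrow> snd x p = snd y p" if "p \<in> P" for p
        using padic_abs_diff_nonneg[OF pr mem mem, of p x y]
          padic_abs_diff_eq_0_iff[OF pr mem mem, of p x y] prime_gt_0_nat[OF pr] that x y
        by (auto simp: divide_le_0_iff)
      thus ?thesis using le[OF x y] by auto
    qed
    also have "\<dots> \<longleftrightarrow> x = y"
      using x y PiE_ext[of "snd x" P padics "snd y"] by (auto simp: XP_def prod_eq_iff)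
    finally show ?thesis .
  qed
  show "XP_dist P x z \<le> XP_dist P x y + XP_dist P y z"
    if x: "x \<in> XP P" and y: "y \<in> XP P" and z: "z \<in> XP P" for x y z
    unfolding le[OF x z]
  proof (intro conjI ballI)
    show "\<bar>fst x - fst z\<bar> \<le> XP_dist P x y + XP_dist P y z"
      using le[OF x y, of "XP_dist P x y"] le[OF y z, of "XP_dist P y z"] by linarith
  next
    fix p assume p: "p \<in> P"
    have "padic_abs p (padic_diff p (snd x p) (snd z p))
        \<le> padic_abs p (padic_diff p (snd x p) (snd y p)) + padic_abs p (padic_diff p (snd y p) (snd z p))"
      using padic_abs_diff_ultrametric[OF pr mem mem mem, of p x y z] p x y z
        padic_abs_diff_nonneg[OF pr mem mem, of p x y] padic_abs_diff_nonneg[OF pr mem mem, of p y z]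
      by auto
    hence "?f x z p \<le> ?f x y p + ?f y z p"
      by (simp add: divide_right_mono flip: add_divide_distrib)
    thus "?f x z p \<le> XP_dist P x y + XP_dist P y z"
      using le[OF x y, of "XP_dist P x y"] le[OF y z, of "XP_dist P y z"] p by fastforce
  qed
qed

section \<open>Balls and cylinders\<close>

definition XP_cball :: "nat set \<Rightarrow> point \<Rightarrow> real \<Rightarrow> point set" where
  "XP_cball P x r = Metric_space.mcball (XP P) (XP_dist P) x r"

definition closed_balls :: "nat set \<Rightarrow> point set set" where
  "closed_balls P = {XP_cball P x r | x r. x \<in> XP P \<and> r > 0}"

text \<open>
  Because of the real factor, a closed ball determines its radius; see
  \<open>ball_radius_XP_cball\<close> below.
\<close>

definition ball_radius :: "nat set \<Rightarrow> point set \<Rightarrow> real" where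
  "ball_radius P B = (THE r. r > 0 \<and> (\<exists>x\<in>XP P. B = XP_cball P x r))"

definition XP_diameter :: "nat set \<Rightarrow> point set \<Rightarrow> real" where
  "XP_diameter P S = (SUP (x, y)\<in>S \<times> S. XP_dist P x y)"

lemma fst_image_XP_cball:
  assumes fin: "finite P" and ne: "P \<noteq> {}" and pr: "\<And>p. p \<in> P \<Longrightarrow> prime p"
    and x: "x \<in> XP P" and r: "r > 0"
  shows "fst ` XP_cball P x r = {fst x - r..fst x + r}"
proof -
  interpret Metric_space "XP P" "XP_dist P" by (rule Metric_space_XP[OF fin ne pr])
  have 1: "(a, snd x) \<in> XP_cball P x r" if "\<bar>a - fst x\<bar> \<le> r" for a
  proof -
    have "snd x p \<in> padics p" if "p \<in> P" for p using that x by (auto simp: XP_def)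
    hence "padic_abs p (padic_diff p (snd x p) (snd x p)) = 0" if "p \<in> P" for p
      using padic_abs_diff_eq_0_iff[OF pr] that by blast
    hence "(SUP p\<in>P. padic_abs p (padic_diff p (snd x p) (snd x p)) / real p)
        = (SUP p\<in>P. 0)" by (intro SUP_cong) simp_all
    hence "(SUP p\<in>P. padic_abs p (padic_diff p (snd x p) (snd x p)) / real p) = 0"
      using ne by simp
    moreover have "(a, snd x) \<in> XP P" using x by (auto simp: XP_def)
    ultimately show ?thesis using that x r by (auto simp: XP_cball_def XP_dist_def abs_le_iff)
  qed
  have 2: "\<bar>fst z - fst x\<bar> \<le> r" if "z \<in> XP_cball P x r" for z
    using that x by (auto simp: XP_cball_def XP_dist_def abs_minus_commute)
  show ?thesis
  proof (intro equalityI subsetI)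
    fix a assume "a \<in> fst ` XP_cball P x r"
    then obtain z where "z \<in> XP_cball P x r" "a = fst z" by blast
    with 2[of z] show "a \<in> {fst x - r..fst x + r}" by (simp add: abs_le_iff)
  next
    fix a assume "a \<in> {fst x - r..fst x + r}"
    hence "\<bar>a - fst x\<bar> \<le> r" by (simp add: abs_le_iff)
    from imageI[OF 1[OF this], of fst] show "a \<in> fst ` XP_cball P x r" by simp
  qed
qed

lemma ball_radius_XP_cball:
  assumes fin: "finite P" and ne: "P \<noteq> {}" and pr: "\<And>p. p \<in> P \<Longrightarrow> prime p"
    and x: "x \<in> XP P" and r: "r > 0"
  shows "ball_radius P (XP_cball P x r) = r"
  unfolding ball_radius_def
proof (rule the_equality)
  show "r > 0 \<and> (\<exists>y\<in>XP P. XP_cball P x r = XP_cball P y r)" using x r by blast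
next
  fix s assume "s > 0 \<and> (\<exists>y\<in>XP P. XP_cball P x r = XP_cball P y s)"
  then obtain y where y: "y \<in> XP P" "s > 0" "XP_cball P x r = XP_cball P y s" by blast
  hence "{fst x - r..fst x + r} = {fst y - s..fst y + s}"
    using fst_image_XP_cball[OF fin ne pr] x r by metis
  thus "s = r" using r y by (auto simp: Icc_eq_Icc)
qed

text \<open>
  The constraining coordinate \<open>i\<close> of a cylinder is \<open>0\<close> (the real coordinate) or a prime
  \<open>p \<in> P\<close> (the coordinate in \<open>\<rat>\<^sub>p\<close>).
\<close>

definition cylinder :: "nat set \<Rightarrow> point \<Rightarrow> real \<Rightarrow> nat \<Rightarrow> point set" where
  "cylinder P x \<epsilon> i =
     (if i = 0 then {z \<in> XP P. \<bar>fst z - fst x\<bar> < \<epsilon>}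
      else {z \<in> XP P. padic_abs i (padic_diff i (snd z i) (snd x i)) < real i * \<epsilon>})"

definition cylinder_radius :: "nat set \<Rightarrow> point \<Rightarrow> real \<Rightarrow> nat \<Rightarrow> real" where
  "cylinder_radius P x \<epsilon> i =
     (if i = 0 then \<epsilon> else Inf {\<epsilon>'. \<epsilon>' > 0 \<and> cylinder P x \<epsilon>' i = cylinder P x \<epsilon> i})"

section \<open>The cylinder absolute game\<close>

definition cyl_alice_legal :: "nat set \<Rightarrow> real \<Rightarrow> point set \<Rightarrow> point set \<Rightarrow> bool" where
  "cyl_alice_legal P \<beta> B C \<longleftrightarrow>
     (\<exists>x\<in>XP P. \<exists>\<epsilon>>0. \<exists>i\<in>insert 0 P.
        C = cylinder P x \<epsilon> i \<and> cylinder_radius P x \<epsilon> i \<le> \<beta> * ball_radius P B)"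

definition cyl_bob_legal :: "nat set \<Rightarrow> real \<Rightarrow> point set \<Rightarrow> point set \<Rightarrow> point set \<Rightarrow> bool" where
  "cyl_bob_legal P \<beta> B C B' \<longleftrightarrow>
     B' \<in> closed_balls P \<and> B' \<subseteq> B - C \<and> ball_radius P B' \<ge> \<beta> * ball_radius P B"

text \<open>
  A strategy \<open>\<sigma>\<close> for Alice maps the list \<open>[B\<^sub>0, \<dots>, B\<^sub>n]\<close> of Bob's moves so far to her next move.
  In \<open>cyl_play P \<beta> \<sigma> B n\<close> Bob has legally played \<open>B\<^sub>0, \<dots>, B\<^sub>n\<close> against \<open>\<sigma>\<close>.
\<close>

definition cyl_play ::
  "nat set \<Rightarrow> real \<Rightarrow> (point set list \<Rightarrow> point set) \<Rightarrow> (nat \<Rightarrow> point set) \<Rightarrow> nat \<Rightarrow> bool" where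
  "cyl_play P \<beta> \<sigma> B n \<longleftrightarrow>
     B 0 \<in> closed_balls P \<and>
     (\<forall>j<n. cyl_bob_legal P \<beta> (B j) (\<sigma> (map B [0..<Suc j])) (B (Suc j)))"

definition cyl_winning_strategy ::
  "nat set \<Rightarrow> real \<Rightarrow> point set \<Rightarrow> (point set list \<Rightarrow> point set) \<Rightarrow> bool" where
  "cyl_winning_strategy P \<beta> F \<sigma> \<longleftrightarrow>
     (\<forall>B n. cyl_play P \<beta> \<sigma> B n \<longrightarrow>
        cyl_alice_legal P \<beta> (B n) (\<sigma> (map B [0..<Suc n])) \<and>
        (\<exists>B'. cyl_bob_legal P \<beta> (B n) (\<sigma> (map B [0..<Suc n])) B')) \<and>
     (\<forall>B. (\<forall>n. cyl_play P \<beta> \<sigma> B n) \<longrightarrow> (\<Inter>n. B n) \<inter> F \<noteq> {})"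

definition cylinder_beta_absolute_winning :: "nat set \<Rightarrow> real \<Rightarrow> point set \<Rightarrow> bool" where
  "cylinder_beta_absolute_winning P \<beta> F \<longleftrightarrow> (\<exists>\<sigma>. cyl_winning_strategy P \<beta> F \<sigma>)"

definition cylinder_absolute_winning :: "nat set \<Rightarrow> point set \<Rightarrow> bool" where
  "cylinder_absolute_winning P F \<longleftrightarrow>
     (\<exists>\<beta>\<^sub>1. 0 < \<beta>\<^sub>1 \<and> \<beta>\<^sub>1 \<le> 1/3 \<and>
        (\<forall>\<beta>\<in>{0<..<\<beta>\<^sub>1}. cylinder_beta_absolute_winning P \<beta> F))"

section \<open>The strong game\<close>

text \<open>
  The rules \<open>A \<subseteq> B \<and> |A| \<ge> \<alpha> |B|\<close> for Alice and \<open>B' \<subseteq> A \<and> |B'| \<ge> \<gamma> |A|\<close> for Bob have the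
  same shape.
\<close>

definition strong_legal :: "nat set \<Rightarrow> real \<Rightarrow> point set \<Rightarrow> point set \<Rightarrow> bool" where
  "strong_legal P c B A \<longleftrightarrow>
     A \<in> closed_balls P \<and> A \<subseteq> B \<and> XP_diameter P A \<ge> c * XP_diameter P B"

definition strong_play ::
  "nat set \<Rightarrow> real \<Rightarrow> (point set list \<Rightarrow> point set) \<Rightarrow> (nat \<Rightarrow> point set) \<Rightarrow> nat \<Rightarrow> bool" where
  "strong_play P \<gamma> \<sigma> B n \<longleftrightarrow>
     B 0 \<in> closed_balls P \<and>
     (\<forall>j<n. strong_legal P \<gamma> (\<sigma> (map B [0..<Suc j])) (B (Suc j)))"

definition strong_winning_strategy ::
  "nat set \<Rightarrow> real \<Rightarrow> real \<Rightarrow> point set \<Rightarrow> (point set list \<Rightarrow> point set) \<Rightarrow> bool" where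
  "strong_winning_strategy P \<alpha> \<gamma> F \<sigma> \<longleftrightarrow>
     (\<forall>B n. strong_play P \<gamma> \<sigma> B n \<longrightarrow> strong_legal P \<alpha> (B n) (\<sigma> (map B [0..<Suc n]))) \<and>
     (\<forall>B. (\<forall>n. strong_play P \<gamma> \<sigma> B n) \<longrightarrow> (\<Inter>n. B n) \<inter> F \<noteq> {})"

definition strong_winning :: "nat set \<Rightarrow> real \<Rightarrow> real \<Rightarrow> point set \<Rightarrow> bool" where
  "strong_winning P \<alpha> \<gamma> F \<longleftrightarrow> (\<exists>\<sigma>. strong_winning_strategy P \<alpha> \<gamma> F \<sigma>)"

definition alpha_strong_winning :: "nat set \<Rightarrow> real \<Rightarrow> point set \<Rightarrow> bool" where
  "alpha_strong_winning P \<alpha> F \<longleftrightarrow> (\<forall>\<gamma>\<in>{0<..<1}. strong_winning P \<alpha> \<gamma> F)"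

end

theory Submission
  imports Defs
begin

text \<open>
  Alice copies a winning strategy of the cylinder game for some \<open>\<beta> \<le> \<alpha> \<gamma>\<close>: whenever that
  strategy deletes a cylinder \<open>C\<close> from Bob's ball \<open>B\<close>, she answers in the strong game with a
  ball \<open>A \<subseteq> B - C\<close> of \<open>\<alpha>\<close> times the radius.  Bob's next ball inside \<open>A\<close> has at least \<open>\<alpha> \<gamma>\<close>
  times the radius of \<open>B\<close>, because the real factor makes the diameter of a ball twice its
  radius, so it is also a legal move in the cylinder game.  Such an \<open>A\<close> exists
  for a real constraint because \<open>\<alpha> < 1/3\<close>.  For a \<open>p\<close>-adic constraint, the \<open>p\<close>-adic coordinate
  of \<open>B\<close> contains two points at a distance \<open>p^m > r\<close> from each other, so one of them is farther
  than \<open>r\<close> from the centre of \<open>C\<close>, whereas \<open>\<alpha> < 1/p\<close> makes the \<open>p\<close>-adic radii of both \<open>A\<close> and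
  \<open>C\<close> smaller than \<open>r\<close>.
\<close>

section \<open>Points of the p-adic numbers at prescribed distances\<close>

lemma rat_padic_abs_power_int:
  assumes p: "prime p"
  shows "rat_padic_abs p (of_nat p powi (- m)) = real p powi m"
proof -
  have p0: "int p \<noteq> 0" and nu: "\<not> is_unit (int p)"
    using p by (auto dest: prime_gt_1_nat)
  have mult: "multiplicity (int p) (int p ^ k) = k" for k
    using p0 nu by (rule multiplicity_same_power)
  show ?thesis
  proof (cases "m \<ge> 0")
    case True
    have "(of_nat p powi (- m) :: rat) = of_int 1 / of_int (int p ^ nat m)"
      using True by (simp add: power_int_def field_simps)
    then show ?thesis
      using rat_padic_abs_eq[OF p, of 1 "int p ^ nat m"] p0 True by (simp add: mult)
  next
    case False
    have "(of_nat p powi (- m) :: rat) = of_int (int p ^ nat (- m)) / of_int 1"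
      using False by (simp add: power_int_def)
    then show ?thesis
      using rat_padic_abs_eq[OF p, of "int p ^ nat (- m)" 1] p0 False by (simp add: mult)
  qed
qed

text \<open>Shifting a representing sequence of \<open>x\<close> by the constant
  \<open>p powi (- m)\<close> keeps it Cauchy, and the difference of the two sequences is constant,
  so the limit defining the distance is immediate.\<close>

lemma padics_at_distance_power_int:
  assumes p: "prime p" and x: "x \<in> padics p"
  obtains w where "w \<in> padics p" "padic_abs p (padic_diff p w x) = real p powi m"
proof -
  obtain s where s: "s \<in> padic_cauchy p" "x = padic_rel p `` {s}"
    using x by (rule padicsE)
  define t where "t = (\<lambda>n. s n + of_nat p powi (- m))"
  have t: "t \<in> padic_cauchy p"
    using s(1) by (simp add: t_def padic_cauchy_def)
  have "(\<lambda>n. rat_padic_abs p (t n - s n))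
      \<longlonglongrightarrow> padic_abs p (padic_diff p (padic_rel p `` {t}) x)"
    using padic_abs_diff_class[OF p t s(1)] s(2) by simp
  moreover have "(\<lambda>n. rat_padic_abs p (t n - s n)) = (\<lambda>n. real p powi m)"
    by (simp add: t_def rat_padic_abs_power_int[OF p])
  ultimately have "padic_abs p (padic_diff p (padic_rel p `` {t}) x) = real p powi m"
    by (simp add: LIMSEQ_const_iff)
  moreover have "padic_rel p `` {t} \<in> padics p"
    using t by (auto simp: padics_def quotient_def)
  ultimately show thesis using that by blast
qed

text \<open>Consecutive powers of \<open>b\<close> differ by the factor \<open>b\<close>, so the
  interval from \<open>r\<close> (excluded) to \<open>b * r\<close> (included) contains one. For
  \<open>b = p\<close> this power is a p-adic distance larger than \<open>r\<close> that still fits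
  into the p-adic radius \<open>p * r\<close> of a ball of radius \<open>r\<close>.\<close>

lemma ex_power_int_between:
  fixes b r :: real
  assumes "b > 1" "r > 0"
  obtains m :: int where "r < b powi m" "b powi m \<le> b * r"
proof -
  define m where "m = \<lfloor>log b (b * r)\<rfloor>"
  have "b powr m \<le> b * r \<and> b * r < b powr (m + 1)"
    using floor_log_eq_powr_iff[of "b * r" b m] assms by (simp add: m_def)
  with assms have "b powi m \<le> b * r" "r < b powi m"
    by (simp_all add: powr_add flip: powr_real_of_int')
  then show thesis using that by blast
qed

text \<open>The game bounds the radius of a cylinder, not the parameter \<epsilon>, which may be
  larger. Each admissible parameter gives a strict bound; at the infimum it becomes a weak
  one.\<close>

lemma padic_abs_le_cylinder_radius:
  assumes i: "i \<noteq> 0" and \<epsilon>: "\<epsilon> > 0" and z: "z \<in> cylinder P y \<epsilon> i"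
  shows "padic_abs i (padic_diff i (snd z i) (snd y i)) \<le> real i * cylinder_radius P y \<epsilon> i"
proof -
  let ?S = "{\<epsilon>'. \<epsilon>' > 0 \<and> cylinder P y \<epsilon>' i = cylinder P y \<epsilon> i}"
  have "padic_abs i (padic_diff i (snd z i) (snd y i)) / real i \<le> Inf ?S"
  proof (rule cInf_greatest)
    show "?S \<noteq> {}" using \<epsilon> by blast
    fix e assume "e \<in> ?S"
    then have "z \<in> cylinder P y e i" using z by simp
    then show "padic_abs i (padic_diff i (snd z i) (snd y i)) / real i \<le> e"
      using i by (simp add: cylinder_def field_simps)
  qed
  then show ?thesis using i by (simp add: cylinder_radius_def field_simps)
qed

section \<open>Balls as products, and their diameters\<close>

context
  fixes P :: "nat set"
  assumes fin: "finite P" and ne: "P \<noteq> {}" and pr: "\<And>p. p \<in> P \<Longrightarrow> prime p"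
begin

interpretation Metric_space "XP P" "XP_dist P"
  by (rule Metric_space_XP[OF fin ne pr])

lemma mem_XP_cball_iff:
  assumes x: "x \<in> XP P"
  shows "z \<in> XP_cball P x r \<longleftrightarrow> z \<in> XP P \<and> \<bar>fst x - fst z\<bar> \<le> r \<and>
    (\<forall>p\<in>P. padic_abs p (padic_diff p (snd x p) (snd z p)) \<le> real p * r)"
proof -
  have "padic_abs p d / real p \<le> r \<longleftrightarrow> padic_abs p d \<le> real p * r" if "p \<in> P" for p d
    using prime_gt_0_nat[OF pr[OF that]] by (simp add: field_simps)
  then show ?thesis
    using x fin ne by (auto simp: XP_cball_def XP_dist_def cSUP_le_iff)
qed

text \<open>The triangle inequality through the centre gives the upper bound; two points over the
  ends of the real interval attain it.\<close>

lemma XP_diameter_XP_cball: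
  assumes x: "x \<in> XP P" and r: "r > 0"
  shows "XP_diameter P (XP_cball P x r) = 2 * r"
proof -
  let ?B = "XP_cball P x r"
  have sub: "?B \<subseteq> XP P" by (auto simp: XP_cball_def)
  have le: "XP_dist P u v \<le> 2 * r" if "u \<in> ?B" "v \<in> ?B" for u v
    using that triangle[of u x v] commute[of u x] by (auto simp: XP_cball_def)
  have "fst x - r \<in> fst ` ?B" "fst x + r \<in> fst ` ?B"
    using r by (simp_all add: fst_image_XP_cball[OF fin ne pr x r])
  from this(1) obtain u where u: "fst x - r = fst u" "u \<in> ?B" by (rule imageE)
  from \<open>fst x + r \<in> fst ` ?B\<close> obtain v where v: "fst x + r = fst v" "v \<in> ?B" by (rule imageE)
  have "2 * r \<le> XP_dist P u v"
    using u v sub r by (auto simp: XP_dist_def)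
  also have "\<dots> \<le> (SUP (a, b)\<in>?B \<times> ?B. XP_dist P a b)"
  proof -
    have "bdd_above ((\<lambda>(a, b). XP_dist P a b) ` (?B \<times> ?B))"
      using le by (intro bdd_aboveI[of _ "2 * r"]) auto
    then show ?thesis
      using cSUP_upper[of "(u, v)" "?B \<times> ?B" "\<lambda>(a, b). XP_dist P a b"] u(2) v(2) by simp
  qed
  finally have "2 * r \<le> XP_diameter P ?B" by (simp add: XP_diameter_def)
  moreover have "XP_diameter P ?B \<le> 2 * r"
    unfolding XP_diameter_def using u(2) le by (intro cSUP_least) auto
  ultimately show ?thesis by simp
qed

lemma XP_diameter_closed_ball:
  "B \<in> closed_balls P \<Longrightarrow> XP_diameter P B = 2 * ball_radius P B"
  by (auto simp: closed_balls_def XP_diameter_XP_cball ball_radius_XP_cball[OF fin ne pr])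

lemma ball_radius_pos: "B \<in> closed_balls P \<Longrightarrow> ball_radius P B > 0"
  by (auto simp: closed_balls_def ball_radius_XP_cball[OF fin ne pr])

section \<open>A small ball that avoids a cylinder\<close>

lemma ex_cball_avoiding_cylinder:
  assumes x: "x \<in> XP P" and r: "r > 0" and y: "y \<in> XP P" and \<epsilon>: "\<epsilon> > 0"
    and i: "i \<in> insert 0 P" and rad: "cylinder_radius P y \<epsilon> i \<le> \<alpha> * r"
    and \<alpha>: "0 < \<alpha>" "\<alpha> < 1/3" and \<alpha>P: "\<And>p. p \<in> P \<Longrightarrow> \<alpha> * real p < 1"
  obtains w where "w \<in> XP P" "XP_cball P w (\<alpha> * r) \<subseteq> XP_cball P x r - cylinder P y \<epsilon> i"
proof -
  have mem: "snd z p \<in> padics p" if "z \<in> XP P" "p \<in> P" for z p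
    using that by (auto simp: XP_def)
  have \<alpha>r: "\<alpha> * r \<le> r / 3" "\<alpha> * r > 0" using \<alpha> r by simp_all
  show thesis
  proof (cases "i = 0")
    case True
    have \<epsilon>r: "\<epsilon> \<le> \<alpha> * r" using rad True by (simp add: cylinder_radius_def)
    \<comment> \<open>The new interval is pushed to the end of the old one that lies away from
      \<open>fst y\<close>. Its points are then at least r - 2 \<alpha> r from \<open>fst y\<close>,
      which is at least \<alpha> r because \<alpha> < 1/3; the cylinder is open, so equality with
      \<epsilon> is harmless.\<close>
    define a where "a = (if fst y \<ge> fst x then fst x - (r - \<alpha> * r) else fst x + (r - \<alpha> * r))"
    have a: "a = fst x - (r - \<alpha> * r) \<and> fst x \<le> fst y \<or> a = fst x + (r - \<alpha> * r) \<and> fst y < fst x"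
      by (simp add: a_def)
    have w: "(a, snd x) \<in> XP P" using x by (auto simp: XP_def)
    have "XP_cball P (a, snd x) (\<alpha> * r) \<subseteq> XP_cball P x r - cylinder P y \<epsilon> i"
    proof
      fix z assume z: "z \<in> XP_cball P (a, snd x) (\<alpha> * r)"
      have za: "\<bar>a - fst z\<bar> \<le> \<alpha> * r" using z mem_XP_cball_iff[OF w] by simp
      have "\<bar>fst x - fst z\<bar> \<le> r" "\<not> \<bar>fst z - fst y\<bar> < \<epsilon>"
        using a za \<epsilon>r \<alpha>r r by linarith+
      moreover have "real p * (\<alpha> * r) \<le> real p * r" for p
        using \<alpha>r r by (intro mult_left_mono) auto
      ultimately show "z \<in> XP_cball P x r - cylinder P y \<epsilon> i"
        using z True
        by (auto simp: mem_XP_cball_iff[OF w] mem_XP_cball_iff[OF x] cylinder_def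
            intro: order_trans)
    qed
    with w that show ?thesis by blast
  next
    case False
    with i have iP: "i \<in> P" by simp
    have p: "prime i" using pr iP .
    let ?d = "\<lambda>a b. padic_abs i (padic_diff i a b)"
    have small: "real i * (\<alpha> * r) < r"
      using \<alpha>P[OF iP] r mult_strict_right_mono[of "\<alpha> * real i" 1 r] by (simp add: mult_ac)
    obtain m where m: "r < real i powi m" "real i powi m \<le> real i * r"
      using ex_power_int_between[of "real i" r] prime_gt_1_nat[OF p] r by auto
    obtain w' where w': "w' \<in> padics i" "?d (snd x i) w' \<le> real i * r" "?d w' (snd y i) > r"
    proof (cases "?d (snd x i) (snd y i) > r")
      case True
      have "?d (snd x i) (snd x i) = 0"
        using padic_abs_diff_eq_0_iff[OF p] mem[OF x iP] by blast
      then show thesis using that[of "snd x i"] True mem[OF x iP] r by simp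
    next
      case F: False
      \<comment> \<open>Here the centre of the cylinder is within \<open>r\<close> of
        \<open>snd x i\<close>. If \<open>v\<close> were too, the ultrametric inequality would put
        \<open>v\<close> within \<open>r\<close> of \<open>snd x i\<close>, against the choice of
        \<open>m\<close>.\<close>
      obtain v where v: "v \<in> padics i" "?d v (snd x i) = real i powi m"
        using padics_at_distance_power_int[OF p mem[OF x iP]] by metis
      have "?d v (snd x i) \<le> max (?d v (snd y i)) (?d (snd y i) (snd x i))"
        by (rule padic_abs_diff_ultrametric[OF p v(1) mem[OF y iP] mem[OF x iP]])
      then have "?d v (snd y i) > r"
        using F m v(2) padic_abs_diff_commute[OF p mem[OF y iP] mem[OF x iP]] by auto
      then show thesis
        using that[of v] v m(2) padic_abs_diff_commute[OF p v(1) mem[OF x iP]] by simp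
    qed
    define w where "w = (fst x, (snd x)(i := w'))"
    have w: "w \<in> XP P"
      using x iP w'(1) by (auto simp: w_def XP_def PiE_iff extensional_def)
    have "XP_cball P w (\<alpha> * r) \<subseteq> XP_cball P x r - cylinder P y \<epsilon> i"
    proof
      fix z assume z: "z \<in> XP_cball P w (\<alpha> * r)"
      have zX: "z \<in> XP P" and z0: "\<bar>fst x - fst z\<bar> \<le> \<alpha> * r"
        and zp: "\<And>q. q \<in> P \<Longrightarrow> padic_abs q (padic_diff q (snd w q) (snd z q)) \<le> real q * (\<alpha> * r)"
        using z mem_XP_cball_iff[OF w] by (auto simp: w_def)
      have zx: "\<bar>fst x - fst z\<bar> \<le> r" using z0 \<alpha>r r by linarith
      have zi: "?d w' (snd z i) < r" using zp[OF iP] small by (simp add: w_def)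
      have "?d w' (snd y i) \<le> max (?d w' (snd z i)) (?d (snd z i) (snd y i))"
        by (rule padic_abs_diff_ultrametric[OF p w'(1) mem[OF zX iP] mem[OF y iP]])
      \<comment> \<open>The first term of the maximum is below \<open>r\<close> while the left-hand
        side exceeds \<open>r\<close>, so the second term must exceed \<open>r\<close>.\<close>
      then have far: "?d (snd z i) (snd y i) > r" using zi w'(3) by auto
      have "z \<notin> cylinder P y \<epsilon> i"
      proof
        assume "z \<in> cylinder P y \<epsilon> i"
        then have "?d (snd z i) (snd y i) \<le> real i * cylinder_radius P y \<epsilon> i"
          by (rule padic_abs_le_cylinder_radius[OF False \<epsilon>])
        also have "\<dots> \<le> real i * (\<alpha> * r)" using rad by (intro mult_left_mono) auto
        finally show False using far small by simp
      qed
      moreover have "padic_abs q (padic_diff q (snd x q) (snd z q)) \<le> real q * r"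
        if q: "q \<in> P" for q
      proof (cases "q = i")
        case True
        have "?d (snd x i) (snd z i) \<le> max (?d (snd x i) w') (?d w' (snd z i))"
          by (rule padic_abs_diff_ultrametric[OF p mem[OF x iP] w'(1) mem[OF zX iP]])
        \<comment> \<open>The facts on \<open>m\<close> serve here to give r < i * r, which turns
          the bound \<open>zi\<close> into the required one.\<close>
        then show ?thesis using True w'(2) zi m by auto
      next
        case False
        have "real q * (\<alpha> * r) \<le> real q * r" using \<alpha>r r by (intro mult_left_mono) auto
        then show ?thesis using zp[OF q] False by (simp add: w_def)
      qed
      ultimately show "z \<in> XP_cball P x r - cylinder P y \<epsilon> i"
        using zX zx by (auto simp: mem_XP_cball_iff[OF x])
    qed
    with w that show ?thesis by blast
  qed
qed

lemma ex_strong_legal_avoiding: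
  assumes B: "B \<in> closed_balls P" and C: "cyl_alice_legal P \<beta> B C" and "\<beta> \<le> \<alpha>"
    and \<alpha>: "0 < \<alpha>" "\<alpha> < 1/3" and \<alpha>P: "\<And>p. p \<in> P \<Longrightarrow> \<alpha> * real p < 1"
  shows "\<exists>A. strong_legal P \<alpha> B A \<and> A \<inter> C = {}"
proof -
  obtain x r where x: "x \<in> XP P" and r: "r > 0" and B_eq: "B = XP_cball P x r"
    using B by (auto simp: closed_balls_def)
  obtain y \<epsilon> i where y: "y \<in> XP P" and \<epsilon>: "\<epsilon> > 0" and i: "i \<in> insert 0 P"
    and C_eq: "C = cylinder P y \<epsilon> i" and rad: "cylinder_radius P y \<epsilon> i \<le> \<beta> * ball_radius P B"
    using C unfolding cyl_alice_legal_def by blast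
  have "\<beta> * r \<le> \<alpha> * r" using \<open>\<beta> \<le> \<alpha>\<close> r by simp
  then have "cylinder_radius P y \<epsilon> i \<le> \<alpha> * r"
    using rad by (simp add: B_eq ball_radius_XP_cball[OF fin ne pr x r])
  then obtain w where w: "w \<in> XP P" "XP_cball P w (\<alpha> * r) \<subseteq> B - C"
    using ex_cball_avoiding_cylinder[OF x r y \<epsilon> i _ \<alpha> \<alpha>P] unfolding B_eq C_eq by metis
  have "\<alpha> * r > 0" using \<alpha> r by simp
  then have "XP_cball P w (\<alpha> * r) \<in> closed_balls P"
    using w(1) unfolding closed_balls_def by blast
  with \<open>\<alpha> * r > 0\<close> have "strong_legal P \<alpha> B (XP_cball P w (\<alpha> * r))"
    using w x r by (auto simp: strong_legal_def B_eq XP_diameter_XP_cball)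
  with w(2) show ?thesis by blast
qed

section \<open>Transfer of the strategy to the strong game\<close>

lemma strong_winning_if_cylinder_winning:
  assumes win: "cyl_winning_strategy P \<beta> F \<sigma>" and \<beta>: "\<beta> \<le> \<alpha> * \<gamma>"
    and \<gamma>: "0 < \<gamma>" "\<gamma> < 1" and \<alpha>: "0 < \<alpha>" "\<alpha> < 1/3" and \<alpha>P: "\<And>p. p \<in> P \<Longrightarrow> \<alpha> * real p < 1"
  shows "strong_winning P \<alpha> \<gamma> F"
proof -
  \<comment> \<open>Histories record only Bob's balls, so \<sigma> can be applied to a history of
    the strong game as it stands. The choice is meaningful on histories that are legal in the
    cylinder game, and \<open>play\<close> shows that all legal histories against \<tau> are of this
    kind.\<close>
  define \<tau> where "\<tau> Bs = (SOME A. strong_legal P \<alpha> (last Bs) A \<and> A \<inter> \<sigma> Bs = {})" for Bs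
  have "\<alpha> * \<gamma> \<le> \<alpha>" using \<gamma> \<alpha> by simp
  with \<beta> have \<beta>\<alpha>: "\<beta> \<le> \<alpha>" by simp
  have ball: "B n \<in> closed_balls P" if "cyl_play P \<beta> \<sigma> B n" for B n
    using that by (cases n) (auto simp: cyl_play_def cyl_bob_legal_def)
  have \<tau>: "strong_legal P \<alpha> (B n) (\<tau> (map B [0..<Suc n])) \<and>
      \<tau> (map B [0..<Suc n]) \<inter> \<sigma> (map B [0..<Suc n]) = {}" if "cyl_play P \<beta> \<sigma> B n" for B n
  proof -
    have "cyl_alice_legal P \<beta> (B n) (\<sigma> (map B [0..<Suc n]))"
      using win that unfolding cyl_winning_strategy_def by blast
    from someI_ex[OF ex_strong_legal_avoiding[OF ball[OF that] this \<beta>\<alpha> \<alpha> \<alpha>P]]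
    show ?thesis by (simp add: \<tau>_def)
  qed
  have play: "cyl_play P \<beta> \<sigma> B n" if "strong_play P \<gamma> \<tau> B n" for B n
    using that
  proof (induction n)
    case 0
    then show ?case by (simp add: strong_play_def cyl_play_def)
  next
    case (Suc n)
    then have pl: "cyl_play P \<beta> \<sigma> B n" by (simp add: strong_play_def)
    let ?A = "\<tau> (map B [0..<Suc n])" and ?B = "B n" and ?B' = "B (Suc n)"
    have leg: "strong_legal P \<gamma> ?A ?B'"
      using Suc.prems unfolding strong_play_def by blast
    have "\<beta> * ball_radius P ?B \<le> (\<alpha> * \<gamma>) * ball_radius P ?B"
      using ball_radius_pos[OF ball[OF pl]] \<beta> by simp
    also have "\<dots> = \<gamma> * (\<alpha> * ball_radius P ?B)" by simp
    also have "\<dots> \<le> \<gamma> * ball_radius P ?A"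
      using \<tau>[OF pl] \<gamma> ball[OF pl]
      by (intro mult_left_mono) (auto simp: strong_legal_def XP_diameter_closed_ball)
    also have "\<dots> \<le> ball_radius P ?B'"
      using leg \<tau>[OF pl] by (auto simp: strong_legal_def XP_diameter_closed_ball)
    \<comment> \<open>Bob's new ball lies in \<open>?A\<close>, which is contained in
      \<open>?B\<close> and disjoint from the cylinder.\<close>
    finally have "cyl_bob_legal P \<beta> ?B (\<sigma> (map B [0..<Suc n])) ?B'"
      using leg \<tau>[OF pl] unfolding cyl_bob_legal_def strong_legal_def by blast
    with pl show ?case unfolding cyl_play_def less_Suc_eq by blast
  qed
  have "strong_winning_strategy P \<alpha> \<gamma> F \<tau>"
    using play \<tau> win unfolding strong_winning_strategy_def cyl_winning_strategy_def by blast
  then show ?thesis unfolding strong_winning_def by blast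
qed

end

theorem proposition5p1:
  fixes P :: "nat set" and F :: "point set" and \<alpha> :: real
  assumes "finite P" and "P \<noteq> {}" and "\<forall>p\<in>P. prime p"
    and "F \<subseteq> XP P" and "cylinder_absolute_winning P F"
    and "0 < \<alpha>" and "\<alpha> < min (1/3) (1 / real (Max P))"
  shows "alpha_strong_winning P \<alpha> F"
  unfolding alpha_strong_winning_def
proof
  fix \<gamma> :: real assume \<gamma>: "\<gamma> \<in> {0<..<1}"
  obtain \<beta>\<^sub>1 where \<beta>\<^sub>1: "0 < \<beta>\<^sub>1" "\<forall>\<beta>\<in>{0<..<\<beta>\<^sub>1}. cylinder_beta_absolute_winning P \<beta> F"
    using assms(5) unfolding cylinder_absolute_winning_def by blast
  \<comment> \<open>The first bound makes Bob's strong moves large enough for the cylinder game;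
    halving \<open>\<beta>\<^sub>1\<close> keeps \<beta> strictly inside the range where a winning
    strategy exists.\<close>
  define \<beta> where "\<beta> = min (\<alpha> * \<gamma>) (\<beta>\<^sub>1 / 2)"
  have "\<beta> \<in> {0<..<\<beta>\<^sub>1}" using \<beta>\<^sub>1(1) \<gamma> assms(6) by (auto simp: \<beta>_def min_def)
  then obtain \<sigma> where "cyl_winning_strategy P \<beta> F \<sigma>"
    using \<beta>\<^sub>1(2) unfolding cylinder_beta_absolute_winning_def by blast
  moreover have "\<alpha> * real p < 1" if "p \<in> P" for p
  proof -
    have p: "0 < p" "p \<le> Max P" using assms(1,3) that by (auto intro: prime_gt_0_nat)
    then have "\<alpha> * real p \<le> \<alpha> * real (Max P)" using assms(6) by (intro mult_left_mono) auto
    also have "\<dots> < 1" using assms(7) p by (simp add: field_simps)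
    finally show ?thesis .
  qed
  moreover have "\<beta> \<le> \<alpha> * \<gamma>" by (simp add: \<beta>_def)
  ultimately show "strong_winning P \<alpha> \<gamma> F"
    using \<gamma> assms
    by (intro strong_winning_if_cylinder_winning[where \<beta> = \<beta> and \<sigma> = \<sigma>]) auto
qed

end
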